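(* Consider the problem $\min_{x\in\mathcal{Q}}\Phi(x)$ with $\Phi=F+h$, $F=\sum_{n=1}^N f_n$, and a Legendre function $w$ with $\mathcal{Q}=\overline{\mathrm{dom}\,w}$, as set up in the context. Suppose that assumptions B1, B2 and B4 (stated in the context) hold. Let $\{x_k\}$ be generated by the PLIAG method (described in the context) with delays bounded by $\tau$ and with constant step size $\alpha_k\equiv\alpha$. Let $L:=\max_{k\ge 0}\sum_{j\in J_k}L_j$, where the $L_j$ are the constants in B1, and suppose $$0<\alpha\le \frac{2}{L\cdot \ell(\tau+1)\cdot(\tau+1)\cdot(\tau+2)},$$ where $\ell$ is the function in B4. For $k\ge 0$ and $x\in\mathrm{dom}\,w$ define $$T_k(x):=\Phi(x_k)-\Phi(x)+L\cdot\ell(\tau+1)\cdot\sum_{i=1}^{\tau} i\cdot D_w(x_{k-\tau+i},x_{k-\tau+i-1}).$$ Then $$T_k(x)\le \frac{1}{\alpha k}D_w(x,x_0),\qquad \forall k\ge 1,\ x\in\mathrm{dom}\,w.$$ In particular, $$\Phi(x_k)-\Phi^*\le \frac{1}{\alpha k}D_w(x^*,x_0),\qquad \forall k\ge 1,\ x^*\in\mathcal{X}.$$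
   Context: Problem: $\mathcal{Q}\subseteq\mathbb{R}^d$ is a nonempty closed convex set with nonempty interior; $F=\sum_{n=1}^N f_n$ with each $f_n$ convex; $h:\mathbb{R}^d\to(-\infty,\infty]$ is proper, lower semicontinuous (lsc) and convex; $\Phi=F+h$. $\mathcal{X}$ is the set of minimizers of $\Phi$ over $\mathcal{Q}$, assumed nonempty and compact, and $\Phi^*$ is the optimal value. $\mathcal{N}=\{1,\dots,N\}$. Legendre function: a proper lsc convex $w:\mathbb{R}^d\to(-\infty,\infty]$ is of Legendre type if $\mathrm{int}\,\mathrm{dom}\,w\ne\emptyset$, $w$ is differentiable on $\mathrm{int}\,\mathrm{dom}\,w$, $\|\nabla w(y_k)\|\to\infty$ for every sequence $\{y_k\}\subseteq\mathrm{int}\,\mathrm{dom}\,w$ converging to a boundary point of $\mathrm{dom}\,w$, and $w$ is strictly convex on $\mathrm{int}\,\mathrm{dom}\,w$. $w$ is a Legendre function with $\mathcal{Q}=\overline{\mathrm{dom}\,w}$. The Bregman distance is $D_w(y,x)=w(y)-w(x)-\langle\nabla w(x),y-x\rangle$ for $y\in\mathrm{dom}\,w$, $x\in\mathrm{int}\,\mathrm{dom}\,w$ (and $+\infty$ if $y\notin\mathrm{dom}\,w$). PLIAG method: $x_0\in\mathrm{int}\,\mathrm{dom}\,w$, $x_k=x_0$ for $k<0$. For each $k\ge 0$ choose $\alpha_k>0$, a nonempty set $J_k\subseteq\mathcal{N}$ with complement $I_k=\mathcal{N}\setminus J_k$, and delays $\tau_k^n\in\{0,1,\dots,\tau\}$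 for $n\in\mathcal{N}$, where the integer $\tau\ge 0$ is the smallest upper bound of all delays; then (with $x_k\in\mathrm{int}\,\mathrm{dom}\,w$) $$x_{k+1}=\arg\min_{x\in\mathcal{Q}}\Big\{h(x)+\sum_{i\in I_k}f_i(x)+\Big\langle\sum_{j\in J_k}\nabla f_j(x_{k-\tau_k^j}),x\Big\rangle+\frac{1}{\alpha_k}D_w(x,x_k)\Big\}.$$ Assumptions: B1. Each $f_n:\mathbb{R}^d\to(-\infty,\infty]$ is proper lsc convex with $\mathrm{dom}\,w\subseteq\mathrm{dom}\,f_n$ and is differentiable on $\mathrm{int}\,\mathrm{dom}\,w$; moreover for each $n\in\mathcal{N}$ there is $L_n>0$ such that $L_nw-f_n$ is convex on $\mathrm{int}\,\mathrm{dom}\,w$. B2. $\mathrm{dom}\,h\cap\mathrm{int}\,\mathrm{dom}\,w\ne\emptyset$, and $\partial h(x)\neq\emptyset$ for all $x\in\mathrm{dom}\,h\cap\mathrm{int}\,\mathrm{dom}\,w$. B4. If $\tau>0$, there is a monotonically increasing function $\ell(\cdot)$ with $\ell(1)=1$ such that for any sequence $\{v_1,\dots,v_k\}\subseteq\mathrm{int}\,\mathrm{dom}\,w$, $D_w(v_k,v_j)\le\ell(k-j)\sum_{i=j}^{k-1}D_w(v_{i+1},v_i)$ for all $j\ge 1$, $k>j+1$. (If $\tau=0$, only the value $\ell(1)=1$ is used.) *)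

theory Defs
  imports "HOL-Analysis.Analysis"
begin

subsection \<open>Extended-real-valued convex analysis\<close>

definition edom :: "('a \<Rightarrow> ereal) \<Rightarrow> 'a set" where
  "edom f = {x. f x < \<infinity>}"

definition eproper :: "('a \<Rightarrow> ereal) \<Rightarrow> bool" where
  "eproper f \<longleftrightarrow> (\<forall>x. f x \<noteq> -\<infinity>) \<and> edom f \<noteq> {}"

definition elsc :: "('a::topological_space \<Rightarrow> ereal) \<Rightarrow> bool" where
  "elsc f \<longleftrightarrow> (\<forall>x. f x \<le> Liminf (at x) f)"

text \<open>The notions of convexity below are only used for functions that do not attain
  \<open>-\<infinity>\<close>, so no indeterminate sum occurs.\<close>

definition econvex :: "('a::real_vector \<Rightarrow> ereal) \<Rightarrow> bool" where
  "econvex f \<longleftrightarrow> (\<forall>x y t. 0 < t \<and> t < 1 \<longrightarrow>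
     f ((1 - t) *\<^sub>R x + t *\<^sub>R y) \<le> ereal (1 - t) * f x + ereal t * f y)"

definition estrictly_convex_on :: "'a::real_vector set \<Rightarrow> ('a \<Rightarrow> ereal) \<Rightarrow> bool" where
  "estrictly_convex_on S f \<longleftrightarrow> convex S \<and> (\<forall>x\<in>S. \<forall>y\<in>S. \<forall>t. x \<noteq> y \<and> 0 < t \<and> t < 1 \<longrightarrow>
     f ((1 - t) *\<^sub>R x + t *\<^sub>R y) < ereal (1 - t) * f x + ereal t * f y)"

definition proper_lsc_convex :: "('a::euclidean_space \<Rightarrow> ereal) \<Rightarrow> bool" where
  "proper_lsc_convex f \<longleftrightarrow> eproper f \<and> elsc f \<and> econvex f"

definition subdiff :: "('a::real_inner \<Rightarrow> ereal) \<Rightarrow> 'a \<Rightarrow> 'a set" where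
  "subdiff f x = {g. x \<in> edom f \<and> (\<forall>y. f x + ereal (g \<bullet> (y - x)) \<le> f y)}"

text \<open>Differentiability and gradients are only used at interior points of the effective domain,
  near which \<open>real_of_ereal (f y)\<close> is the finite value of \<open>f\<close>.\<close>

definition ediff_at :: "('a::real_inner \<Rightarrow> ereal) \<Rightarrow> 'a \<Rightarrow> bool" where
  "ediff_at f x \<longleftrightarrow> (\<lambda>y. real_of_ereal (f y)) differentiable (at x)"

definition grad :: "('a::real_inner \<Rightarrow> ereal) \<Rightarrow> 'a \<Rightarrow> 'a" where
  "grad f x = (THE g. GDERIV (\<lambda>y. real_of_ereal (f y)) x :> g)"

definition legendre :: "('a::euclidean_space \<Rightarrow> ereal) \<Rightarrow> bool" where
  "legendre w \<longleftrightarrow>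
     proper_lsc_convex w \<and>
     interior (edom w) \<noteq> {} \<and>
     (\<forall>x\<in>interior (edom w). ediff_at w x) \<and>
     (\<forall>y z. (\<forall>k::nat. y k \<in> interior (edom w)) \<and> y \<longlonglongrightarrow> z \<and> z \<in> frontier (edom w) \<longrightarrow>
        filterlim (\<lambda>k. norm (grad w (y k))) at_top sequentially) \<and>
     estrictly_convex_on (interior (edom w)) w"

text \<open>The second argument is meant to range over \<open>interior (edom w)\<close>.\<close>

definition bregman :: "('a::real_inner \<Rightarrow> ereal) \<Rightarrow> 'a \<Rightarrow> 'a \<Rightarrow> ereal" where
  "bregman w y x =
     (if y \<in> edom w then w y - w x - ereal (grad w x \<bullet> (y - x)) else \<infinity>)"

subsection \<open>The problem and the PLIAG method\<close>

definition Phi :: "nat \<Rightarrow> (nat \<Rightarrow> 'a \<Rightarrow> ereal) \<Rightarrow> ('a \<Rightarrow> ereal) \<Rightarrow> 'a \<Rightarrow> ereal" where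
  "Phi N f h x = (\<Sum>n\<in>{1..N}. f n x) + h x"

definition minimizers :: "'a set \<Rightarrow> ('a \<Rightarrow> ereal) \<Rightarrow> 'a set" where
  "minimizers Q \<phi> = {x. is_arg_min \<phi> (\<lambda>y. y \<in> Q) x}"

definition pliag_objective ::
  "('a::euclidean_space \<Rightarrow> ereal) \<Rightarrow> nat \<Rightarrow> (nat \<Rightarrow> 'a \<Rightarrow> ereal) \<Rightarrow> ('a \<Rightarrow> ereal) \<Rightarrow>
   (nat \<Rightarrow> real) \<Rightarrow> (nat \<Rightarrow> nat set) \<Rightarrow> (nat \<Rightarrow> nat \<Rightarrow> nat) \<Rightarrow> (int \<Rightarrow> 'a) \<Rightarrow> nat \<Rightarrow> 'a \<Rightarrow> ereal" where
  "pliag_objective w N f h \<alpha> J delay x k y =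
     h y + (\<Sum>i\<in>{1..N} - J k. f i y)
       + ereal ((\<Sum>j\<in>J k. grad (f j) (x (int k - int (delay k j)))) \<bullet> y)
       + ereal (1 / \<alpha> k) * bregman w y (x (int k))"

text \<open>Iterates are indexed by integers so that delayed indices may be negative.\<close>

definition pliag ::
  "('a::euclidean_space \<Rightarrow> ereal) \<Rightarrow> 'a set \<Rightarrow> nat \<Rightarrow> (nat \<Rightarrow> 'a \<Rightarrow> ereal) \<Rightarrow> ('a \<Rightarrow> ereal) \<Rightarrow>
   (nat \<Rightarrow> real) \<Rightarrow> (nat \<Rightarrow> nat set) \<Rightarrow> nat \<Rightarrow> (nat \<Rightarrow> nat \<Rightarrow> nat) \<Rightarrow> (int \<Rightarrow> 'a) \<Rightarrow> bool" where
  "pliag w Q N f h \<alpha> J \<tau> delay x \<longleftrightarrow>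
     (\<forall>k. x k \<in> interior (edom w)) \<and>
     (\<forall>k<0. x k = x 0) \<and>
     (\<forall>k. 0 < \<alpha> k) \<and>
     (\<forall>k. J k \<noteq> {} \<and> J k \<subseteq> {1..N}) \<and>
     (\<forall>k. \<forall>n\<in>{1..N}. delay k n \<le> \<tau>) \<and>
     \<tau> = (LEAST t. \<forall>k. \<forall>n\<in>{1..N}. delay k n \<le> t) \<and>
     (\<forall>k. x (int k + 1) \<in> minimizers Q (pliag_objective w N f h \<alpha> J delay x k))"

definition pliag_T ::
  "('a::euclidean_space \<Rightarrow> ereal) \<Rightarrow> nat \<Rightarrow> (nat \<Rightarrow> 'a \<Rightarrow> ereal) \<Rightarrow> ('a \<Rightarrow> ereal) \<Rightarrow>
   real \<Rightarrow> (nat \<Rightarrow> real) \<Rightarrow> nat \<Rightarrow> (int \<Rightarrow> 'a) \<Rightarrow> nat \<Rightarrow> 'a \<Rightarrow> ereal" where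
  "pliag_T w N f h L ell \<tau> x k y =
     Phi N f h (x (int k)) - Phi N f h y
       + ereal (L * ell (\<tau> + 1)) *
         (\<Sum>i\<in>{1..\<tau>}. ereal (real i) *
            bregman w (x (int k - int \<tau> + int i)) (x (int k - int \<tau> + int i - 1)))"

subsection \<open>Assumptions\<close>

definition relatively_smooth_components ::
  "('a::euclidean_space \<Rightarrow> ereal) \<Rightarrow> nat \<Rightarrow> (nat \<Rightarrow> 'a \<Rightarrow> ereal) \<Rightarrow> (nat \<Rightarrow> real) \<Rightarrow> bool" where
  "relatively_smooth_components w N f Lc \<longleftrightarrow>
     (\<forall>n\<in>{1..N}.
        proper_lsc_convex (f n) \<and>
        edom w \<subseteq> edom (f n) \<and>
        (\<forall>x\<in>interior (edom w). ediff_at (f n) x) \<and>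
        0 < Lc n \<and>
        convex_on (interior (edom w))
          (\<lambda>x. Lc n * real_of_ereal (w x) - real_of_ereal (f n x)))"

definition regularizer_compatible ::
  "('a::euclidean_space \<Rightarrow> ereal) \<Rightarrow> ('a \<Rightarrow> ereal) \<Rightarrow> bool" where
  "regularizer_compatible w h \<longleftrightarrow>
     edom h \<inter> interior (edom w) \<noteq> {} \<and>
     (\<forall>x\<in>edom h \<inter> interior (edom w). subdiff h x \<noteq> {})"

text \<open>Only the values of \<open>ell\<close> at positive integers matter; for \<open>\<tau> = 0\<close> only \<open>ell 1 = 1\<close> is required.\<close>

definition bregman_path_bound ::
  "('a::euclidean_space \<Rightarrow> ereal) \<Rightarrow> nat \<Rightarrow> (nat \<Rightarrow> real) \<Rightarrow> bool" where
  "bregman_path_bound w \<tau> ell \<longleftrightarrow>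
     ell 1 = 1 \<and>
     (0 < \<tau> \<longrightarrow>
        mono_on {1..} ell \<and>
        (\<forall>v k j. (\<forall>i\<in>{1..k}. v i \<in> interior (edom w)) \<and> 1 \<le> j \<and> j + 1 < k \<longrightarrow>
           bregman w (v k) (v j)
             \<le> ereal (ell (k - j)) * (\<Sum>i\<in>{j..k - 1}. bregman w (v (i + 1)) (v i))))"

end

(* Comparing the objective at x_(k+1) with its values on the segment towards u gives the three-point
   inequality for the Bregman proximal step; relative smoothness bounds the error of the delayed
   linearisations by c * (d_(k-tau) + ... + d_k), where d_i = D_w(x_(i+1), x_i) and c = L ell(tau+1).
   Hence Phi(x_(k+1)) - Phi(u) <= c * (d_(k-tau) + ... + d_k) + (D_w(u, x_k) - D_w(u, x_(k+1)) - d_k) / alpha.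
   The weighted sum in T_k turns the window of delayed terms into a telescoping term plus
   c (tau+1) d_k, which the step size bound absorbs. The choice u = x_k shows that T_k decreases, and
   summing over k for fixed u gives the rate. *)

theory Submission
  imports Defs
begin

section \<open>Real-valued forms of extended-real functions\<close>

text \<open>Makes derivatives and real arithmetic available. It agrees with \<open>bregman\<close>
  when both points lie in \<open>edom w\<close>; elsewhere \<open>real_of_ereal\<close> replaces
  infinite values by 0.\<close>

definition real_bregman :: "('a::real_inner \<Rightarrow> ereal) \<Rightarrow> 'a \<Rightarrow> 'a \<Rightarrow> real" where
  "real_bregman w y x =
     real_of_ereal (w y) - real_of_ereal (w x) - grad w x \<bullet> (y - x)"

lemma edom_ereal:
  assumes "eproper f" "x \<in> edom f"
  shows "f x = ereal (real_of_ereal (f x))"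
  using assms by (cases "f x") (auto simp: eproper_def edom_def)

lemma bregman_ereal:
  assumes "eproper w" "y \<in> edom w" "x \<in> edom w"
  shows "bregman w y x = ereal (real_bregman w y x)"
proof -
  obtain r s where "w y = ereal r" "w x = ereal s"
    using edom_ereal[OF assms(1,2)] edom_ereal[OF assms(1,3)] by metis
  then show ?thesis
    using assms(2) by (simp add: bregman_def real_bregman_def)
qed

lemma real_bregman_self [simp]: "real_bregman w x x = 0"
  by (simp add: real_bregman_def)

text \<open>With finite endpoint values the right-hand side of the \<open>econvex\<close> inequality
  is finite, so the value in between is finite too. Hence the domain is convex and the inequality
  can be read in the reals.\<close>

lemma econvex_convex_on:
  assumes "eproper f" "econvex f"
  shows "convex_on (edom f) (\<lambda>x. real_of_ereal (f x))"
proof -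
  have *: "(1 - t) *\<^sub>R x + t *\<^sub>R y \<in> edom f \<and>
      real_of_ereal (f ((1 - t) *\<^sub>R x + t *\<^sub>R y))
        \<le> (1 - t) * real_of_ereal (f x) + t * real_of_ereal (f y)"
    if "0 < t" "t < 1" "x \<in> edom f" "y \<in> edom f" for t x y
  proof -
    let ?z = "(1 - t) *\<^sub>R x + t *\<^sub>R y"
    have "f ?z \<le> ereal (1 - t) * f x + ereal t * f y"
      using assms(2) that unfolding econvex_def by blast
    also have "\<dots> = ereal ((1 - t) * real_of_ereal (f x) + t * real_of_ereal (f y))"
      by (subst (1) edom_ereal[OF assms(1) that(3)], subst (1) edom_ereal[OF assms(1) that(4)]) simp
    finally have le: "f ?z \<le> \<dots>" .
    then have "?z \<in> edom f"
      by (auto simp: edom_def intro: le_less_trans)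
    then show ?thesis
      using le edom_ereal[OF assms(1), of ?z] by (metis ereal_less_eq(3))
  qed
  have "convex (edom f)"
    unfolding convex_alt
  proof (intro ballI allI impI)
    fix x y and u :: real
    assume "x \<in> edom f" "y \<in> edom f" "0 \<le> u \<and> u \<le> 1"
    then show "(1 - u) *\<^sub>R x + u *\<^sub>R y \<in> edom f"
      using *[of u x y] by (cases "u = 0 \<or> u = 1") auto
  qed
  then show ?thesis
    by (intro convex_onI) (use * in auto)
qed

section \<open>Gradients and first-order inequalities along segments\<close>

text \<open>Riesz representation: the derivative \<open>D\<close> is the inner product with
  \<open>adjoint D 1\<close>. Uniqueness of derivatives makes the description in \<open>grad\<close>
  well defined.\<close>

lemma grad_has_derivative:
  fixes f :: "'a::euclidean_space \<Rightarrow> ereal"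
  assumes "ediff_at f x"
  shows "((\<lambda>y. real_of_ereal (f y)) has_derivative (\<lambda>v. grad f x \<bullet> v)) (at x)"
proof -
  let ?g = "\<lambda>y. real_of_ereal (f y)"
  obtain D where D: "(?g has_derivative D) (at x)"
    using assms by (auto simp: ediff_at_def differentiable_def)
  then interpret linear D
    by (rule has_derivative_linear)
  have "D = (\<lambda>v. v \<bullet> adjoint D 1)"
    using adjoint_works[OF linear_axioms, of _ 1] by (auto simp: fun_eq_iff)
  then have G: "GDERIV ?g x :> adjoint D 1"
    using D by (simp add: gderiv_def)
  have "GDERIV ?g x :> grad f x"
    unfolding grad_def
  proof (rule theI[of "\<lambda>g. GDERIV ?g x :> g", OF G])
    fix g assume "GDERIV ?g x :> g"
    then have "(\<lambda>v. v \<bullet> g) = (\<lambda>v. v \<bullet> adjoint D 1)"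
      using G has_derivative_unique unfolding gderiv_def by blast
    then show "g = adjoint D 1"
      by (metis vector_eq_ldot)
  qed
  then show ?thesis
    by (simp add: gderiv_def inner_commute)
qed

text \<open>The difference quotients along \<open>v\<close> are at least \<open>c\<close> and tend
  to \<open>D v\<close> from the right. One-sided data suffice, which suits a convex set known only
  in the direction of another of its points.\<close>

lemma has_derivative_directional_ge:
  fixes \<phi> :: "'a::real_normed_vector \<Rightarrow> real"
  assumes "(\<phi> has_derivative D) (at a)"
    and ge: "\<And>t. 0 < t \<Longrightarrow> t < 1 \<Longrightarrow> t * c \<le> \<phi> (a + t *\<^sub>R v) - \<phi> a"
  shows "c \<le> D v"
proof -
  have "((\<lambda>t. \<phi> (a + t *\<^sub>R v)) has_derivative (\<lambda>t. D (t *\<^sub>R v))) (at 0)"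
    by (rule has_derivative_compose[where g = \<phi>, of "\<lambda>t. a + t *\<^sub>R v"])
      (use assms(1) in \<open>auto intro!: derivative_eq_intros\<close>)
  moreover have "(\<lambda>t. D (t *\<^sub>R v)) = (\<lambda>t. D v * t)"
    using linear_cmul[OF has_derivative_linear[OF assms(1)]] by (auto simp: mult.commute)
  ultimately have "((\<lambda>t. \<phi> (a + t *\<^sub>R v)) has_field_derivative D v) (at 0)"
    by (simp add: has_field_derivative_def)
  then have "((\<lambda>t. (\<phi> (a + t *\<^sub>R v) - \<phi> a) / t) \<longlongrightarrow> D v) (at_right 0)"
    by (auto simp: DERIV_def intro: filterlim_at_within_not_equal tendsto_within_subset)
  moreover have "\<forall>\<^sub>F t in at_right 0. c \<le> (\<phi> (a + t *\<^sub>R v) - \<phi> a) / t"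
    unfolding eventually_at_right_field
    by (rule exI[of _ 1]) (use ge in \<open>auto simp: field_simps\<close>)
  ultimately show ?thesis
    by (rule tendsto_lowerbound) simp
qed

lemma convex_on_sum_functions:
  assumes "convex S" "\<And>i. i \<in> I \<Longrightarrow> convex_on S (\<phi> i)"
  shows "convex_on S (\<lambda>x. \<Sum>i\<in>I. \<phi> i x)"
  using assms(2)
  by (induction I rule: infinite_finite_induct)
    (auto simp: convex_on_const assms(1) intro!: convex_on_add)

lemma convex_on_segment:
  assumes "convex_on S \<phi>" "a \<in> S" "u \<in> S" "0 < t" "t < 1"
  shows "a + t *\<^sub>R (u - a) \<in> S" "\<phi> (a + t *\<^sub>R (u - a)) \<le> \<phi> a + t * (\<phi> u - \<phi> a)"
proof -
  have eq: "a + t *\<^sub>R (u - a) = (1 - t) *\<^sub>R a + t *\<^sub>R u"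
    by (simp add: algebra_simps)
  show "a + t *\<^sub>R (u - a) \<in> S"
    using assms convex_on_imp_convex[OF assms(1)] unfolding eq convex_alt by force
  show "\<phi> (a + t *\<^sub>R (u - a)) \<le> \<phi> a + t * (\<phi> u - \<phi> a)"
    using convex_onD[OF assms(1), of t a u] assms unfolding eq by (simp add: algebra_simps)
qed

text \<open>Convexity bounds increments along the segment from above, so the directional bound is
  applied to the negated function. Only points of the segment enter, hence \<open>u\<close> may be a
  boundary point of \<open>S\<close>.\<close>

lemma convex_on_has_derivative_le:
  fixes \<phi> :: "'a::real_normed_vector \<Rightarrow> real"
  assumes "convex_on S \<phi>" "a \<in> S" "u \<in> S" "(\<phi> has_derivative D) (at a)"
  shows "\<phi> a + D (u - a) \<le> \<phi> u"
proof -
  have "\<phi> a - \<phi> u \<le> - D (u - a)"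
    by (rule has_derivative_directional_ge[OF has_derivative_minus[OF assms(4)]])
      (use convex_on_segment(2)[OF assms(1-3)] in \<open>simp add: algebra_simps\<close>)
  then show ?thesis
    by simp
qed

lemma econvex_gradient_inequality:
  fixes f :: "'a::euclidean_space \<Rightarrow> ereal"
  assumes "eproper f" "econvex f" "ediff_at f a" "a \<in> edom f" "u \<in> edom f"
  shows "real_of_ereal (f a) + grad f a \<bullet> (u - a) \<le> real_of_ereal (f u)"
  using convex_on_has_derivative_le[OF econvex_convex_on[OF assms(1,2)] assms(4,5)
      grad_has_derivative[OF assms(3)]] .

section \<open>Bregman distances and the proximal inequality\<close>

lemma real_bregman_nonneg:
  fixes w :: "'a::euclidean_space \<Rightarrow> ereal"
  assumes "eproper w" "econvex w" "ediff_at w x" "x \<in> edom w" "y \<in> edom w"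
  shows "0 \<le> real_bregman w y x"
  using econvex_gradient_inequality[OF assms] by (simp add: real_bregman_def)

text \<open>The descent lemma with a Bregman distance in place of the squared norm: it is the
  gradient inequality at \<open>a\<close> for the convex function c w - f, rearranged.\<close>

lemma relatively_smooth_upper_bound:
  fixes f w :: "'a::euclidean_space \<Rightarrow> ereal"
  assumes "convex_on S (\<lambda>x. c * real_of_ereal (w x) - real_of_ereal (f x))"
    and "ediff_at f a" "ediff_at w a" "a \<in> S" "u \<in> S"
  shows "real_of_ereal (f u)
    \<le> real_of_ereal (f a) + grad f a \<bullet> (u - a) + c * real_bregman w u a"
proof -
  have "((\<lambda>x. c * real_of_ereal (w x) - real_of_ereal (f x)) has_derivative
      (\<lambda>v. c * (grad w a \<bullet> v) - grad f a \<bullet> v)) (at a)"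
    by (intro derivative_intros grad_has_derivative assms)
  from convex_on_has_derivative_le[OF assms(1,4,5) this]
  show ?thesis
    by (simp add: real_bregman_def algebra_simps)
qed

lemma real_bregman_has_derivative:
  fixes w :: "'a::euclidean_space \<Rightarrow> ereal"
  assumes "ediff_at w a"
  shows "((\<lambda>y. real_bregman w y z) has_derivative (\<lambda>v. (grad w a - grad w z) \<bullet> v)) (at a)"
  unfolding real_bregman_def
  by (rule derivative_eq_intros grad_has_derivative[OF assms] refl)+ (simp add: inner_diff_left)

text \<open>Minimality is only tested along the segment towards \<open>u\<close>, so no subdifferential sum rule
  is needed.\<close>

lemma bregman_prox_inequality:
  fixes w :: "'a::euclidean_space \<Rightarrow> ereal"
  assumes "convex_on C \<psi>" "a \<in> C" "u \<in> C" "ediff_at w a" "0 < \<alpha>"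
    and min: "\<And>y. y \<in> C \<Longrightarrow> \<psi> a + real_bregman w a z / \<alpha> \<le> \<psi> y + real_bregman w y z / \<alpha>"
  shows "\<psi> a - \<psi> u \<le> (real_bregman w u z - real_bregman w u a - real_bregman w a z) / \<alpha>"
proof -
  \<comment> \<open>Along the segment \<psi> rises by at most t times
    \<open>\<psi> u - \<psi> a\<close>, so minimality at \<open>a\<close> forces the Bregman term to
    grow at least at the rate \<open>\<alpha> * (\<psi> a - \<psi> u)\<close>.\<close>
  have "\<alpha> * (\<psi> a - \<psi> u) \<le> (grad w a - grad w z) \<bullet> (u - a)"
  proof (rule has_derivative_directional_ge[OF real_bregman_has_derivative[OF assms(4)]])
    fix t :: real assume t: "0 < t" "t < 1"
    let ?p = "a + t *\<^sub>R (u - a)"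
    have "\<psi> a + real_bregman w a z / \<alpha> \<le> \<psi> a + t * (\<psi> u - \<psi> a) + real_bregman w ?p z / \<alpha>"
      using min[OF convex_on_segment(1)[OF assms(1-3) t]] convex_on_segment(2)[OF assms(1-3) t]
      by linarith
    then have "t * (\<psi> a - \<psi> u) \<le> (real_bregman w ?p z - real_bregman w a z) / \<alpha>"
      by (simp add: diff_divide_distrib algebra_simps)
    then show "t * (\<alpha> * (\<psi> a - \<psi> u)) \<le> real_bregman w ?p z - real_bregman w a z"
      using assms(5) by (simp add: field_simps)
  qed
  \<comment> \<open>Three-point identity: all values of \<open>w\<close> cancel and only the
    gradient difference remains.\<close>
  moreover have "(grad w a - grad w z) \<bullet> (u - a)
      = real_bregman w u z - real_bregman w u a - real_bregman w a z"
    by (simp add: real_bregman_def algebra_simps)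
  ultimately show ?thesis
    using assms(5) by (simp add: field_simps)
qed

section \<open>Weighted sums of delayed terms and the abstract rate\<close>

text \<open>Summation by parts: moving the window by one lowers the weight of each old term by 1 and
  adds the newest with weight t. Adding and subtracting the newest term completes the window to t +
  1 terms.\<close>

lemma weighted_window_difference:
  fixes d :: "int \<Rightarrow> real"
  shows "(\<Sum>i\<in>{1..t}. real i * d (m + int i)) - (\<Sum>i\<in>{1..t}. real i * d (m + int i - 1))
    = real (t + 1) * d (m + int t) - (\<Sum>i\<in>{0..t}. d (m + int i))"
  by (induction t) (simp_all add: algebra_simps)

text \<open>The terms with negative index vanish, and what is left is an initial part of the
  unshifted sum.\<close>

lemma sum_shifted_le:
  fixes d :: "int \<Rightarrow> real"
  assumes "\<And>m. 0 \<le> d m" "\<And>m. m < 0 \<Longrightarrow> d m = 0"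
  shows "(\<Sum>k<K. d (int k - int s)) \<le> (\<Sum>k<K. d (int k))"
proof -
  have "(\<Sum>k<K. d (int k - int s)) = (\<Sum>k\<in>{s..<K}. d (int k - int s))"
    by (rule sum.mono_neutral_right) (auto simp: assms(2))
  also have "\<dots> = (\<Sum>k<K - s. d (int k))"
    by (rule sum.reindex_bij_witness[of _ "\<lambda>k. k + s" "\<lambda>k. k - s"]) (auto simp: of_nat_diff)
  also have "\<dots> \<le> (\<Sum>k<K. d (int k))"
    by (rule sum_mono2) (auto simp: assms(1))
  finally show ?thesis .
qed

text \<open>After exchanging the sums, each weight i multiplies a copy of the series shifted by t +
  1 - i; the weights add up to t (t + 1) / 2.\<close>

lemma sum_weighted_windows_le:
  fixes d :: "int \<Rightarrow> real"
  assumes "\<And>m. 0 \<le> d m" "\<And>m. m < 0 \<Longrightarrow> d m = 0"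
  shows "(\<Sum>k<K. \<Sum>i\<in>{1..t}. real i * d (int k - int t + int i - 1))
    \<le> real t * real (t + 1) / 2 * (\<Sum>k<K. d (int k))"
proof -
  have "(\<Sum>k<K. \<Sum>i\<in>{1..t}. real i * d (int k - int t + int i - 1))
      = (\<Sum>i\<in>{1..t}. real i * (\<Sum>k<K. d (int k - int (t + 1 - i))))"
    by (subst sum.swap) (auto simp: sum_distrib_left of_nat_diff algebra_simps intro!: sum.cong)
  also have "\<dots> \<le> (\<Sum>i\<in>{1..t}. real i * (\<Sum>k<K. d (int k)))"
    by (intro sum_mono mult_left_mono sum_shifted_le assms) auto
  also have "\<dots> = (\<Sum>i\<in>{1..t}. real i) * (\<Sum>k<K. d (int k))"
    by (simp add: sum_distrib_right)
  also have "(\<Sum>i\<in>{1..t}. real i) = real t * real (t + 1) / 2"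
    by (induction t) (auto simp: field_simps)
  finally show ?thesis .
qed

text \<open>Hypothesis \<open>mono\<close> is \<open>step\<close> at the previous iterate; it starts at \<open>k = 1\<close> because the
  initial point need not lie in the domain of the regularizer.\<close>

lemma delayed_descent_rate:
  fixes d :: "int \<Rightarrow> real" and P b :: "nat \<Rightarrow> real"
  assumes d_nonneg: "\<And>m. 0 \<le> d m" and d_neg: "\<And>m. m < 0 \<Longrightarrow> d m = 0"
    and "0 < c" "0 < \<alpha>" and \<alpha>: "\<alpha> \<le> 2 / (c * real (\<tau> + 1) * real (\<tau> + 2))"
    and b_nonneg: "\<And>k. 0 \<le> b k"
    and step: "\<And>k. P (Suc k) - p
      \<le> c * (\<Sum>i\<in>{0..\<tau>}. d (int k - int \<tau> + int i)) + (b k - b (Suc k) - d (int k)) / \<alpha>"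
    and mono: "\<And>k. 1 \<le> k \<Longrightarrow> P (Suc k) - P k
      \<le> c * (\<Sum>i\<in>{0..\<tau>}. d (int k - int \<tau> + int i)) - d (int k) / \<alpha>"
    and "1 \<le> K"
  shows "P K - p + c * (\<Sum>i\<in>{1..\<tau>}. real i * d (int K - int \<tau> + int i - 1)) \<le> b 0 / (\<alpha> * real K)"
proof -
  \<comment> \<open>The window of \<open>V k\<close> ends at the index k - 1, so
    \<open>V (Suc k)\<close> is the first one to contain \<open>d (int k)\<close>.\<close>
  define V where "V k = (\<Sum>i\<in>{1..\<tau>}. real i * d (int k - int \<tau> + int i - 1))" for k
  define T where "T k = P k - p + c * V k" for k
  have V_Suc: "c * V (Suc k) + c * (\<Sum>i\<in>{0..\<tau>}. d (int k - int \<tau> + int i))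
      = c * V k + c * real (\<tau> + 1) * d (int k)" for k
  proof -
    have "V (Suc k) + (\<Sum>i\<in>{0..\<tau>}. d (int k - int \<tau> + int i)) = V k + real (\<tau> + 1) * d (int k)"
      using weighted_window_difference[where d = d and t = \<tau> and m = "int k - int \<tau>"]
      unfolding V_def by (simp add: algebra_simps)
    then show ?thesis
      by (metis distrib_left mult.assoc)
  qed
  have inv: "c * real (\<tau> + 1) * real (\<tau> + 2) / 2 \<le> 1 / \<alpha>"
  proof -
    have "0 < c * real (\<tau> + 1) * real (\<tau> + 2)"
      using \<open>0 < c\<close> by simp
    with \<alpha> have "\<alpha> * (c * real (\<tau> + 1) * real (\<tau> + 2)) \<le> 2"
      by (simp only: pos_le_divide_eq)
    then show ?thesis
      by (subst pos_le_divide_eq[OF \<open>0 < \<alpha>\<close>]) (simp only: mult.commute times_divide_eq_right)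
  qed
  have d_le: "c * real (\<tau> + 1) * real (\<tau> + 2) / 2 * d m \<le> d m / \<alpha>" for m
    using mult_right_mono[OF inv d_nonneg[of m]] by simp
  \<comment> \<open>The step size constant splits as (\<tau> + 1) (\<tau> + 2) / 2 = (\<tau> + 1) +
    \<tau> (\<tau> + 1) / 2. The first part pays for the new term in \<open>V_Suc\<close>; the
    second is saved to cancel the sum of all \<open>V k\<close> at the end.\<close>
  have T_Suc: "T (Suc k) \<le> c * V k - c * (real \<tau> * real (\<tau> + 1) / 2 * d (int k))
      + (b k - b (Suc k)) / \<alpha>" for k
  proof -
    have "c * real (\<tau> + 1) * real (\<tau> + 2) / 2 * d (int k)
        = c * real (\<tau> + 1) * d (int k) + c * (real \<tau> * real (\<tau> + 1) / 2 * d (int k))"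
      by (simp add: field_simps)
    moreover have "(b k - b (Suc k) - d (int k)) / \<alpha> = (b k - b (Suc k)) / \<alpha> - d (int k) / \<alpha>"
      by (rule diff_divide_distrib)
    ultimately show ?thesis
      using step[of k] V_Suc[of k] d_le[of "int k"] unfolding T_def by linarith
  qed
  \<comment> \<open>Here the weaker consequence 1 / \<alpha> \<ge> c (\<tau> + 1) is enough, since
    \<tau> + 2 \<ge> 2.\<close>
  have T_le: "T (Suc k) \<le> T k" if "1 \<le> k" for k
  proof -
    have "c * real (\<tau> + 1) * 2 \<le> c * real (\<tau> + 1) * real (\<tau> + 2)"
      using \<open>0 < c\<close> by (intro mult_left_mono) auto
    then have "c * real (\<tau> + 1) * d (int k) \<le> c * real (\<tau> + 1) * real (\<tau> + 2) / 2 * d (int k)"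
      by (intro mult_right_mono d_nonneg) auto
    then show ?thesis
      using mono[OF that] V_Suc[of k] d_le[of "int k"] unfolding T_def by linarith
  qed
  have T_antimono: "T K \<le> T k" if "1 \<le> k" "k \<le> K" for k
    using that(2,1) by (induction K rule: dec_induct) (auto intro: order_trans[OF T_le])
  \<comment> \<open>Monotonicity compares \<open>T K\<close> with its average over the indices 1 to
    K, so \<open>T 0\<close> never occurs.\<close>
  have "real K * T K = (\<Sum>k<K. T K)"
    by simp
  also have "\<dots> \<le> (\<Sum>k<K. T (Suc k))"
    by (intro sum_mono T_antimono) auto
  also have "\<dots> \<le> (\<Sum>k<K. c * V k - c * (real \<tau> * real (\<tau> + 1) / 2 * d (int k))
      + (b k - b (Suc k)) / \<alpha>)"
    by (intro sum_mono T_Suc)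
  also have "\<dots> = c * ((\<Sum>k<K. V k) - real \<tau> * real (\<tau> + 1) / 2 * (\<Sum>k<K. d (int k)))
      + (b 0 - b K) / \<alpha>"
  proof -
    have "(\<Sum>k<K. (b k - b (Suc k)) / \<alpha>) = (b 0 - b K) / \<alpha>"
      using sum_lessThan_telescope'[of b K] by (simp only: sum_divide_distrib[symmetric])
    then show ?thesis
      by (simp only: sum.distrib sum_subtractf sum_distrib_left right_diff_distrib)
  qed
  \<comment> \<open>The saved multiples of \<open>d\<close> dominate the accumulated windows, and
    the last distance \<open>b K\<close> is dropped as nonnegative.\<close>
  also have "\<dots> \<le> b 0 / \<alpha>"
  proof -
    have "c * ((\<Sum>k<K. V k) - real \<tau> * real (\<tau> + 1) / 2 * (\<Sum>k<K. d (int k))) \<le> 0"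
      using sum_weighted_windows_le[of d \<tau> K, OF d_nonneg d_neg] \<open>0 < c\<close>
      unfolding V_def by (intro mult_nonneg_nonpos) auto
    moreover have "(b 0 - b K) / \<alpha> \<le> b 0 / \<alpha>"
      using b_nonneg[of K] \<open>0 < \<alpha>\<close> by (simp add: divide_right_mono)
    ultimately show ?thesis by linarith
  qed
  finally have "T K \<le> b 0 / (\<alpha> * real K)"
    using \<open>1 \<le> K\<close> \<open>0 < \<alpha>\<close> by (simp add: field_simps)
  then show ?thesis
    by (simp add: T_def V_def)
qed

section \<open>The real form of the objective and one PLIAG step\<close>

definition real_Phi :: "nat \<Rightarrow> (nat \<Rightarrow> 'a \<Rightarrow> ereal) \<Rightarrow> ('a \<Rightarrow> ereal) \<Rightarrow> 'a \<Rightarrow> real" where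
  "real_Phi N f h y = (\<Sum>n\<in>{1..N}. real_of_ereal (f n y)) + real_of_ereal (h y)"

lemma sum_edom_ereal:
  assumes "\<And>i. i \<in> I \<Longrightarrow> eproper (f i) \<and> y \<in> edom (f i)"
  shows "(\<Sum>i\<in>I. f i y) = ereal (\<Sum>i\<in>I. real_of_ereal (f i y))"
proof -
  have "(\<Sum>i\<in>I. f i y) = (\<Sum>i\<in>I. ereal (real_of_ereal (f i y)))"
    using assms by (intro sum.cong) (auto intro: edom_ereal)
  then show ?thesis
    by simp
qed

lemma Phi_ereal:
  assumes "\<And>n. n \<in> {1..N} \<Longrightarrow> eproper (f n) \<and> y \<in> edom (f n)" "eproper h" "y \<in> edom h"
  shows "Phi N f h y = ereal (real_Phi N f h y)"
  using sum_edom_ereal[of "{1..N}" f y] assms edom_ereal[OF assms(2,3)]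
  unfolding Phi_def real_Phi_def by (metis plus_ereal.simps(1))

lemma Phi_eq_infinity:
  assumes "\<And>n. n \<in> {1..N} \<Longrightarrow> eproper (f n) \<and> y \<in> edom (f n)" "y \<notin> edom h"
  shows "Phi N f h y = \<infinity>"
  using sum_edom_ereal[of "{1..N}" f y] assms unfolding Phi_def by (auto simp: edom_def)

text \<open>Converts a distance across a delay into consecutive distances over one fixed window.
  Monotonicity of \<open>ell\<close> and nonnegativity of the terms let every delay up to \<tau>
  share the same constant and window.\<close>

lemma bregman_path_delay:
  fixes w :: "'a::euclidean_space \<Rightarrow> ereal" and x :: "int \<Rightarrow> 'a"
  assumes path: "bregman_path_bound w \<tau> ell"
    and w: "eproper w" "econvex w" "\<And>z. z \<in> interior (edom w) \<Longrightarrow> ediff_at w z"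
    and x: "\<And>m. x m \<in> interior (edom w)" and "\<delta> \<le> \<tau>"
  shows "1 \<le> ell (\<tau> + 1)"
    and "real_bregman w (x (k + 1)) (x (k - int \<delta>)) \<le> ell (\<tau> + 1) *
      (\<Sum>i\<in>{0..\<tau>}. real_bregman w (x (k - int \<tau> + int i + 1)) (x (k - int \<tau> + int i)))"
proof -
  have xe: "x m \<in> edom w" for m
    using x interior_subset by blast
  define d where "d m = real_bregman w (x (m + 1)) (x m)" for m
  have d: "0 \<le> d m" for m
    unfolding d_def by (intro real_bregman_nonneg w x xe)
  have ell_mono: "ell p \<le> ell q" if "0 < \<tau>" "1 \<le> p" "p \<le> q" for p q
    using path that by (auto simp: bregman_path_bound_def monotone_on_def)
  have ell1: "ell 1 = 1"
    using path by (simp add: bregman_path_bound_def)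
  show ell_ge: "1 \<le> ell (\<tau> + 1)"
    using ell_mono[of 1 "\<tau> + 1"] ell1 by (cases "\<tau> = 0") auto
  let ?S = "\<Sum>i\<in>{0..\<tau>}. d (k - int \<tau> + int i)"
  have S: "0 \<le> ?S"
    by (intro sum_nonneg d)
  have "real_bregman w (x (k + 1)) (x (k - int \<delta>)) \<le> ell (\<tau> + 1) * ?S"
  \<comment> \<open>Without delay the path has a single step, while
    \<open>bregman_path_bound\<close> speaks of at least two. The distance is then itself a window
    term, and \<open>ell (\<tau> + 1)\<close> is at least 1.\<close>
  proof (cases "\<delta> = 0")
    case True
    have "d k \<le> ?S"
      using member_le_sum[of \<tau> "{0..\<tau>}" "\<lambda>i. d (k - int \<tau> + int i)"] d by simp
    also have "\<dots> \<le> ell (\<tau> + 1) * ?S"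
      using mult_right_mono[OF ell_ge S] by simp
    finally show ?thesis
      using True by (simp add: d_def)
  next
    case False
    with \<open>\<delta> \<le> \<tau>\<close> have "0 < \<tau>" by simp
    \<comment> \<open>The shift makes \<open>v 1\<close> the delayed point and
      \<open>v (\<delta> + 2)\<close> the new iterate, as path indices start at 1.\<close>
    define v where "v i = x (k - int \<delta> - 1 + int i)" for i
    have "bregman w (v (\<delta> + 2)) (v 1)
        \<le> ereal (ell (\<delta> + 2 - 1)) * (\<Sum>i\<in>{1..\<delta> + 2 - 1}. bregman w (v (i + 1)) (v i))"
    proof -
      have "\<forall>v k j. (\<forall>i\<in>{1..k}. v i \<in> interior (edom w)) \<and> 1 \<le> j \<and> j + 1 < k \<longrightarrow>
          bregman w (v k) (v j)
            \<le> ereal (ell (k - j)) * (\<Sum>i\<in>{j..k - 1}. bregman w (v (i + 1)) (v i))"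
        using path \<open>0 < \<tau>\<close> unfolding bregman_path_bound_def by blast
      moreover have "(\<forall>i\<in>{1..\<delta> + 2}. v i \<in> interior (edom w)) \<and> 1 \<le> (1::nat) \<and> 1 + 1 < \<delta> + 2"
        using False x by (simp add: v_def)
      ultimately show ?thesis
        by blast
    qed
    moreover have "bregman w (v i) (v j) = ereal (real_bregman w (v i) (v j))" for i j
      unfolding v_def by (intro bregman_ereal w xe)
    ultimately have "real_bregman w (v (\<delta> + 2)) (v 1)
        \<le> ell (\<delta> + 1) * (\<Sum>i\<in>{1..\<delta> + 1}. real_bregman w (v (i + 1)) (v i))"
      by simp
    also have "(\<Sum>i\<in>{1..\<delta> + 1}. real_bregman w (v (i + 1)) (v i))
        = (\<Sum>i\<in>{\<tau> - \<delta>..\<tau>}. d (k - int \<tau> + int i))"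
      by (rule sum.reindex_bij_witness[of _ "\<lambda>i. i + \<delta> + 1 - \<tau>" "\<lambda>i. i + \<tau> - \<delta> - 1"])
        (use \<open>\<delta> \<le> \<tau>\<close> in \<open>auto simp: d_def v_def of_nat_diff algebra_simps\<close>)
    also have "ell (\<delta> + 1) * \<dots> \<le> ell (\<tau> + 1) * ?S"
      using \<open>\<delta> \<le> \<tau>\<close> \<open>0 < \<tau>\<close> ell_ge
      by (intro mult_mono ell_mono sum_mono2 sum_nonneg d) auto
    finally show ?thesis
      by (simp add: v_def algebra_simps)
  qed
  then show "real_bregman w (x (k + 1)) (x (k - int \<delta>)) \<le> ell (\<tau> + 1) *
      (\<Sum>i\<in>{0..\<tau>}. real_bregman w (x (k - int \<tau> + int i + 1)) (x (k - int \<tau> + int i)))"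
    by (simp add: d_def)
qed

lemma pliag_objective_ereal:
  assumes "eproper w" "y \<in> edom w" "x (int k) \<in> edom w"
    and "\<And>n. n \<in> {1..N} \<Longrightarrow> eproper (f n) \<and> y \<in> edom (f n)"
    and "eproper h" "y \<in> edom h"
  shows "pliag_objective w N f h (\<lambda>_. \<alpha>) J delay x k y =
    ereal (real_of_ereal (h y) + (\<Sum>i\<in>{1..N} - J k. real_of_ereal (f i y))
      + (\<Sum>j\<in>J k. grad (f j) (x (int k - int (delay k j)))) \<bullet> y
      + real_bregman w y (x (int k)) / \<alpha>)"
proof -
  obtain r where r: "h y = ereal r"
    using edom_ereal[OF assms(5,6)] by blast
  have "(\<Sum>i\<in>{1..N} - J k. f i y) = ereal (\<Sum>i\<in>{1..N} - J k. real_of_ereal (f i y))"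
    using assms(4) by (intro sum_edom_ereal) auto
  then show ?thesis
    by (simp add: pliag_objective_def bregman_ereal[OF assms(1-3)] r)
qed

text \<open>The subproblem is a Bregman proximal step for a convex function in which the components
  in \<open>J k\<close> are linearised at delayed points. The proximal inequality treats that
  function; the linearisation error becomes the sum of delayed distances.\<close>

lemma pliag_step:
  fixes w h :: "'a::euclidean_space \<Rightarrow> ereal" and x :: "int \<Rightarrow> 'a"
  assumes w: "eproper w" "econvex w" "\<And>z. z \<in> interior (edom w) \<Longrightarrow> ediff_at w z"
    and h: "eproper h" "econvex h" "edom h \<inter> edom w \<noteq> {}"
    and rel_smooth: "relatively_smooth_components w N f Lc"
    and Q: "edom w \<subseteq> Q" and pliag: "pliag w Q N f h (\<lambda>_. \<alpha>) J \<tau> delay x"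
  shows "x (int k + 1) \<in> edom h"
    and "u \<in> edom h \<Longrightarrow> u \<in> edom w \<Longrightarrow> real_Phi N f h (x (int k + 1)) - real_Phi N f h u
      \<le> (\<Sum>j\<in>J k. Lc j * real_bregman w (x (int k + 1)) (x (int k - int (delay k j))))
        + (real_bregman w u (x (int k)) - real_bregman w u (x (int k + 1))
            - real_bregman w (x (int k + 1)) (x (int k))) / \<alpha>"
proof -
  define a z where "a = x (int k + 1)" and "z = x (int k)"
  define y where "y j = x (int k - int (delay k j))" for j
  have x_int: "x m \<in> interior (edom w)" for m
    using pliag by (simp add: pliag_def)
  then have x_dom: "x m \<in> edom w" for m
    using interior_subset by blast
  have "0 < \<alpha>" and J: "J k \<subseteq> {1..N}"
    using pliag by (auto simp: pliag_def)
  have min: "\<not> pliag_objective w N f h (\<lambda>_. \<alpha>) J delay x k y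
      < pliag_objective w N f h (\<lambda>_. \<alpha>) J delay x k a" if "y \<in> edom w" for y
    using pliag Q that unfolding pliag_def minimizers_def is_arg_min_def a_def by blast
  have f: "eproper (f n)" "econvex (f n)" "edom w \<subseteq> edom (f n)"
    "\<And>z. z \<in> interior (edom w) \<Longrightarrow> ediff_at (f n) z"
    "convex_on (interior (edom w))
      (\<lambda>x. Lc n * real_of_ereal (w x) - real_of_ereal (f n x))" if "n \<in> {1..N}" for n
    using rel_smooth that
    by (auto simp: relatively_smooth_components_def proper_lsc_convex_def)
  define \<psi> where "\<psi> y = real_of_ereal (h y) + (\<Sum>i\<in>{1..N} - J k. real_of_ereal (f i y))
      + (\<Sum>j\<in>J k. grad (f j) (x (int k - int (delay k j)))) \<bullet> y" for y
  let ?C = "edom h \<inter> edom w"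
  have obj: "pliag_objective w N f h (\<lambda>_. \<alpha>) J delay x k y
      = ereal (\<psi> y + real_bregman w y z / \<alpha>)" if "y \<in> ?C" for y
    unfolding \<psi>_def z_def by (rule pliag_objective_ereal) (use that f w(1) h(1) x_dom in auto)
  obtain y0 where "y0 \<in> ?C"
    using h(3) by blast
  \<comment> \<open>A point of \<open>?C\<close> has a finite objective value, so a minimizer cannot
    have an infinite one.\<close>
  show a_h: "x (int k + 1) \<in> edom h"
  proof (rule ccontr)
    assume "x (int k + 1) \<notin> edom h"
    then have "h a = \<infinity>"
      by (auto simp: edom_def a_def)
    moreover have "(\<Sum>i\<in>{1..N} - J k. f i a) = ereal (\<Sum>i\<in>{1..N} - J k. real_of_ereal (f i a))"
      unfolding a_def by (intro sum_edom_ereal) (use f(1,3) x_dom in blast)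
    moreover have "bregman w a z = ereal (real_bregman w a z)"
      unfolding a_def z_def by (intro bregman_ereal w x_dom)
    ultimately have "pliag_objective w N f h (\<lambda>_. \<alpha>) J delay x k a = \<infinity>"
      by (simp add: pliag_objective_def z_def)
    then show False
      using min[of y0] obj[OF \<open>y0 \<in> ?C\<close>] \<open>y0 \<in> ?C\<close> by simp
  qed
  have a_C: "a \<in> ?C"
    using a_h x_dom by (simp add: a_def)
  assume "u \<in> edom h" "u \<in> edom w"
  then have u_C: "u \<in> ?C"
    by simp
  have conv_w: "convex (edom w)" and conv_h: "convex (edom h)"
    using econvex_convex_on w h convex_on_imp_convex by blast+
  have conv_C: "convex ?C"
    by (intro convex_Int conv_w conv_h)
  have "convex_on ?C \<psi>"
    unfolding \<psi>_def
  proof (intro convex_on_add)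
    show "convex_on ?C (\<lambda>y. real_of_ereal (h y))"
      using convex_on_subset[OF econvex_convex_on[OF h(1,2)] _ conv_C] by blast
    show "convex_on ?C (\<lambda>y. \<Sum>i\<in>{1..N} - J k. real_of_ereal (f i y))"
    proof (rule convex_on_sum_functions[OF conv_C])
      fix i assume "i \<in> {1..N} - J k"
      then show "convex_on ?C (\<lambda>y. real_of_ereal (f i y))"
        using convex_on_subset[OF econvex_convex_on[OF f(1,2)] _ conv_C] f(3) by blast
    qed
    show "convex_on ?C ((\<bullet>) (\<Sum>j\<in>J k. grad (f j) (x (int k - int (delay k j)))))"
      by (intro convex_onI conv_C) (simp add: inner_add_right)
  qed
  then have prox: "\<psi> a - \<psi> u \<le> (real_bregman w u z - real_bregman w u a - real_bregman w a z) / \<alpha>"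
  proof (rule bregman_prox_inequality[OF _ a_C u_C])
    show "ediff_at w a"
      unfolding a_def by (intro w x_int)
    show "\<psi> a + real_bregman w a z / \<alpha> \<le> \<psi> y + real_bregman w y z / \<alpha>" if "y \<in> ?C" for y
      using min[of y] obj[OF that] obj[OF a_C] that by simp
  qed fact
  \<comment> \<open>The delayed point \<open>y j\<close> serves as an intermediate: relative
    smoothness leads from it to \<open>a\<close>, and convexity from it to \<open>u\<close>, which
    need only lie in \<open>edom w\<close>.\<close>
  have "real_of_ereal (f j a) - real_of_ereal (f j u)
      \<le> grad (f j) (y j) \<bullet> (a - u) + Lc j * real_bregman w a (y j)" if "j \<in> J k" for j
  proof -
    have j: "j \<in> {1..N}"
      using that J by blast
    have "real_of_ereal (f j a)
        \<le> real_of_ereal (f j (y j)) + grad (f j) (y j) \<bullet> (a - y j) + Lc j * real_bregman w a (y j)"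
      unfolding a_def y_def
      by (intro relatively_smooth_upper_bound[OF f(5)[OF j]] f(4)[OF j] w x_int)
    moreover have "real_of_ereal (f j (y j)) + grad (f j) (y j) \<bullet> (u - y j) \<le> real_of_ereal (f j u)"
      using f[OF j] x_int x_dom \<open>u \<in> edom w\<close> unfolding y_def
      by (intro econvex_gradient_inequality) auto
    ultimately show ?thesis
      by (simp add: inner_diff_right)
  qed
  then have "(\<Sum>j\<in>J k. real_of_ereal (f j a) - real_of_ereal (f j u))
      \<le> (\<Sum>j\<in>J k. grad (f j) (y j) \<bullet> (a - u) + Lc j * real_bregman w a (y j))"
    by (intro sum_mono)
  then have "(\<Sum>j\<in>J k. real_of_ereal (f j a)) - (\<Sum>j\<in>J k. real_of_ereal (f j u))
      \<le> (\<Sum>j\<in>J k. grad (f j) (y j)) \<bullet> a - (\<Sum>j\<in>J k. grad (f j) (y j)) \<bullet> u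
        + (\<Sum>j\<in>J k. Lc j * real_bregman w a (y j))"
    by (simp add: sum.distrib sum_subtractf inner_sum_left inner_diff_right)
  \<comment> \<open>The regularizer and the components outside \<open>J k\<close> are contained in
    \<psi>, and the linear terms of \<psi> cancel the gradient terms of the bound just
    obtained.\<close>
  moreover have "real_Phi N f h p = real_of_ereal (h p)
      + (\<Sum>i\<in>{1..N} - J k. real_of_ereal (f i p)) + (\<Sum>j\<in>J k. real_of_ereal (f j p))" for p
    using sum.subset_diff[OF J, of "\<lambda>n. real_of_ereal (f n p)"] by (simp add: real_Phi_def)
  ultimately show "real_Phi N f h (x (int k + 1)) - real_Phi N f h u
      \<le> (\<Sum>j\<in>J k. Lc j * real_bregman w (x (int k + 1)) (x (int k - int (delay k j))))
        + (real_bregman w u (x (int k)) - real_bregman w u (x (int k + 1))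
            - real_bregman w (x (int k + 1)) (x (int k))) / \<alpha>"
    using prox unfolding \<psi>_def a_def[symmetric] z_def[symmetric] y_def[symmetric] by simp
qed

section \<open>The convergence rate of the method\<close>

theorem theorem4p1:
  fixes w h :: "'a::euclidean_space \<Rightarrow> ereal"
    and f :: "nat \<Rightarrow> 'a \<Rightarrow> ereal"
    and Q :: "'a set"
    and N \<tau> :: nat
    and Lc ell :: "nat \<Rightarrow> real"
    and L \<alpha> :: real
    and J :: "nat \<Rightarrow> nat set"
    and delay :: "nat \<Rightarrow> nat \<Rightarrow> nat"
    and x :: "int \<Rightarrow> 'a"
  assumes "Q \<noteq> {}" and "closed Q" and "convex Q" and "interior Q \<noteq> {}"
    and "proper_lsc_convex h"
    and "minimizers Q (Phi N f h) \<noteq> {}" and "compact (minimizers Q (Phi N f h))"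
    and "legendre w" and "Q = closure (edom w)"
    and "relatively_smooth_components w N f Lc"
    and "regularizer_compatible w h"
    and "bregman_path_bound w \<tau> ell"
    and "pliag w Q N f h (\<lambda>_. \<alpha>) J \<tau> delay x"
    and "L = Max (range (\<lambda>k. \<Sum>j\<in>J k. Lc j))"
    and "0 < \<alpha>"
    and "\<alpha> \<le> 2 / (L * ell (\<tau> + 1) * real (\<tau> + 1) * real (\<tau> + 2))"
  shows "(\<forall>k\<ge>1. \<forall>y\<in>edom w.
            pliag_T w N f h L ell \<tau> x k y \<le> ereal (1 / (\<alpha> * real k)) * bregman w y (x 0))
       \<and> (\<forall>k\<ge>1. \<forall>xstar\<in>minimizers Q (Phi N f h).
            Phi N f h (x (int k)) - (INF y\<in>Q. Phi N f h y)
              \<le> ereal (1 / (\<alpha> * real k)) * bregman w xstar (x 0))"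
proof -
  have w: "eproper w" "econvex w" "\<And>z. z \<in> interior (edom w) \<Longrightarrow> ediff_at w z"
    using \<open>legendre w\<close> by (auto simp: legendre_def proper_lsc_convex_def)
  have h: "eproper h" "econvex h"
    using \<open>proper_lsc_convex h\<close> by (auto simp: proper_lsc_convex_def)
  obtain y0 where y0: "y0 \<in> edom h" "y0 \<in> edom w"
    using \<open>regularizer_compatible w h\<close> interior_subset
    unfolding regularizer_compatible_def by blast
  then have h_w: "edom h \<inter> edom w \<noteq> {}"
    by blast
  have Q: "edom w \<subseteq> Q"
    using \<open>Q = closure (edom w)\<close> closure_subset by blast
  note pl = \<open>pliag w Q N f h (\<lambda>_. \<alpha>) J \<tau> delay x\<close>
  have x_int: "x m \<in> interior (edom w)" for m
    using pl by (simp add: pliag_def)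
  then have x_dom: "x m \<in> edom w" for m
    using interior_subset by blast
  have x_neg: "x m = x 0" if "m < 0" for m
    using pl that by (simp add: pliag_def)
  have J: "J k \<noteq> {}" "J k \<subseteq> {1..N}" for k
    using pl by (auto simp: pliag_def)
  have delay: "delay k j \<le> \<tau>" if "j \<in> J k" for k j
    using pl J[of k] that unfolding pliag_def by blast
  note rs = \<open>relatively_smooth_components w N f Lc\<close>
  have Lc: "0 < Lc j" if "j \<in> J k" for k j
    using rs J(2)[of k] that unfolding relatively_smooth_components_def by blast
  have f: "eproper (f n) \<and> y \<in> edom (f n)" if "n \<in> {1..N}" "y \<in> edom w" for n y
    using rs that by (auto simp: relatively_smooth_components_def proper_lsc_convex_def)
  have x_Suc_h: "x (int k + 1) \<in> edom h" for k
    by (rule pliag_step(1)[OF w h h_w rs Q pl])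
  have x_h: "x (int k) \<in> edom h" if "1 \<le> k" for k
    using x_Suc_h[of "k - 1"] that by (simp add: of_nat_diff)
  have sum_Lc_le: "(\<Sum>j\<in>J k. Lc j) \<le> L" for k
  proof -
    \<comment> \<open>The sets \<open>J k\<close> are subsets of a finite set, so only finitely many
      sums occur and \<open>Max\<close> is a genuine upper bound.\<close>
    have "range (\<lambda>k. \<Sum>j\<in>J k. Lc j) \<subseteq> (\<lambda>A. \<Sum>j\<in>A. Lc j) ` Pow {1..N}"
      using J(2) by auto
    then have "finite (range (\<lambda>k. \<Sum>j\<in>J k. Lc j))"
      by (rule finite_subset) simp
    then show ?thesis
      using \<open>L = Max (range (\<lambda>k. \<Sum>j\<in>J k. Lc j))\<close> by auto
  qed
  have "0 < (\<Sum>j\<in>J 0. Lc j)"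
    using J Lc finite_subset[OF J(2)] by (intro sum_pos) auto
  then have "0 < L"
    using sum_Lc_le[of 0] by linarith
  note path = bregman_path_delay[OF \<open>bregman_path_bound w \<tau> ell\<close> w x_int]
  define c where "c = L * ell (\<tau> + 1)"
  have ell: "1 \<le> ell (\<tau> + 1)"
    by (rule path(1)) auto
  then have "0 < c"
    using \<open>0 < L\<close> by (simp add: c_def)
  define d where "d m = real_bregman w (x (m + 1)) (x m)" for m
  have d_nonneg: "0 \<le> d m" for m
    unfolding d_def by (intro real_bregman_nonneg w x_int x_dom)
  \<comment> \<open>The iterates are constant up to time 0. The index -1 is separate because its
    successor is 0 itself.\<close>
  have d_neg: "d m = 0" if "m < 0" for m
    using that x_neg[of m] x_neg[of "m + 1"] by (cases "m = -1") (auto simp: d_def)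
  have delayed: "(\<Sum>j\<in>J k. Lc j * real_bregman w (x (int k + 1)) (x (int k - int (delay k j))))
      \<le> c * (\<Sum>i\<in>{0..\<tau>}. d (int k - int \<tau> + int i))" for k
  proof -
    let ?S = "\<Sum>i\<in>{0..\<tau>}. d (int k - int \<tau> + int i)"
    have "(\<Sum>j\<in>J k. Lc j * real_bregman w (x (int k + 1)) (x (int k - int (delay k j))))
        \<le> (\<Sum>j\<in>J k. Lc j * (ell (\<tau> + 1) * ?S))"
      unfolding d_def by (intro sum_mono mult_left_mono path(2) delay less_imp_le[OF Lc])
    also have "\<dots> = (\<Sum>j\<in>J k. Lc j) * (ell (\<tau> + 1) * ?S)"
      by (simp add: sum_distrib_right)
    also have "\<dots> \<le> L * (ell (\<tau> + 1) * ?S)"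
      using ell by (intro mult_right_mono sum_Lc_le mult_nonneg_nonneg sum_nonneg d_nonneg) auto
    finally show ?thesis
      by (simp add: c_def mult.assoc)
  qed
  let ?P = "real_Phi N f h"
  have step: "?P (x (int (Suc k))) - ?P u \<le> c * (\<Sum>i\<in>{0..\<tau>}. d (int k - int \<tau> + int i))
      + (real_bregman w u (x (int k)) - real_bregman w u (x (int (Suc k))) - d (int k)) / \<alpha>"
    if "u \<in> edom h" "u \<in> edom w" for k u
    using pliag_step(2)[OF w h h_w rs Q pl that, of k] delayed[of k]
    by (simp add: d_def add.commute)
  have Phi_real: "Phi N f h y = ereal (?P y)" if "y \<in> edom h" "y \<in> edom w" for y
    using that f h by (intro Phi_ereal) auto
  have T: "pliag_T w N f h L ell \<tau> x k u \<le> ereal (1 / (\<alpha> * real k)) * bregman w u (x 0)"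
    if "1 \<le> k" "u \<in> edom w" for k u
  proof -
    have Phi_x: "Phi N f h (x (int k)) = ereal (?P (x (int k)))"
      using x_h[OF \<open>1 \<le> k\<close>] x_dom by (rule Phi_real)
    have T_eq: "pliag_T w N f h L ell \<tau> x k u = ereal (?P (x (int k))) - Phi N f h u
        + ereal (c * (\<Sum>i\<in>{1..\<tau>}. real i * d (int k - int \<tau> + int i - 1)))"
      by (simp add: pliag_T_def Phi_x bregman_ereal[OF w(1) x_dom x_dom] c_def d_def)
    show ?thesis
    proof (cases "u \<in> edom h")
      case True
      have "?P (x (int k)) - ?P u + c * (\<Sum>i\<in>{1..\<tau>}. real i * d (int k - int \<tau> + int i - 1))
          \<le> real_bregman w u (x (int 0)) / (\<alpha> * real k)"
      proof (rule delayed_descent_rate[where P = "\<lambda>k. ?P (x (int k))"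
            and b = "\<lambda>k. real_bregman w u (x (int k))"])
        show "\<alpha> \<le> 2 / (c * real (\<tau> + 1) * real (\<tau> + 2))"
          unfolding c_def by fact
        show "0 \<le> real_bregman w u (x (int k))" for k
          by (intro real_bregman_nonneg w x_int x_dom that)
        \<comment> \<open>Take the current iterate as comparison point: its distance to itself is 0,
          and its distance to the next iterate is dropped. This requires a finite value of
          \<open>h\<close> there, hence k \<ge> 1.\<close>
        show "?P (x (int (Suc k))) - ?P (x (int k))
            \<le> c * (\<Sum>i\<in>{0..\<tau>}. d (int k - int \<tau> + int i)) - d (int k) / \<alpha>" if "1 \<le> k" for k
        proof -
          have "0 \<le> real_bregman w (x (int k)) (x (int (Suc k))) / \<alpha>"
            using \<open>0 < \<alpha>\<close> by (intro divide_nonneg_pos real_bregman_nonneg w x_int x_dom)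
          then show ?thesis
            using step[OF x_h[OF that] x_dom, of k] by (simp add: diff_divide_distrib)
        qed
      qed (fact \<open>0 < c\<close> \<open>0 < \<alpha>\<close> d_nonneg d_neg step[OF True \<open>u \<in> edom w\<close>] \<open>1 \<le> k\<close>)+
      then show ?thesis
        by (simp add: T_eq Phi_real[OF True that(2)] bregman_ereal[OF w(1) that(2) x_dom])
    next
      \<comment> \<open>With an infinite value at \<open>u\<close> and a finite one at the iterate,
        the left-hand side is minus infinity.\<close>
      case False
      then have "Phi N f h u = \<infinity>"
        using f that by (intro Phi_eq_infinity) auto
      then show ?thesis
        by (simp add: T_eq)
    qed
  qed
  have "Phi N f h (x (int k)) - (INF y\<in>Q. Phi N f h y)
      \<le> ereal (1 / (\<alpha> * real k)) * bregman w xs (x 0)"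
    if "1 \<le> k" and xs: "xs \<in> minimizers Q (Phi N f h)" for k xs
  proof (cases "xs \<in> edom w")
    case True
    have min: "Phi N f h xs \<le> Phi N f h y" if "y \<in> Q" for y
      using xs that by (auto simp: minimizers_def is_arg_min_def not_less)
    have "xs \<in> Q"
      using xs by (simp add: minimizers_def is_arg_min_def)
    with min have "(INF y\<in>Q. Phi N f h y) = Phi N f h xs"
      by (intro antisym INF_lower INF_greatest)
    \<comment> \<open>The delay terms in \<open>pliag_T\<close> are nonnegative, so the objective
      gap is at most \<open>pliag_T\<close>.\<close>
    moreover have "Phi N f h (x (int k)) - Phi N f h xs \<le> pliag_T w N f h L ell \<tau> x k xs"
    proof -
      have "0 \<le> c * (\<Sum>i\<in>{1..\<tau>}. real i * d (int k - int \<tau> + int i - 1))"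
        using \<open>0 < c\<close> by (intro mult_nonneg_nonneg sum_nonneg d_nonneg) auto
      then show ?thesis
        by (simp add: pliag_T_def bregman_ereal[OF w(1) x_dom x_dom] c_def d_def
            ereal_le_add_self)
    qed
    ultimately show ?thesis
      using T[OF \<open>1 \<le> k\<close> True] by simp
  next
    \<comment> \<open>A minimizer over the closure may lie outside \<open>edom w\<close>; its
      Bregman distance is then infinite and the bound is trivial.\<close>
    case False
    then show ?thesis
      using \<open>1 \<le> k\<close> \<open>0 < \<alpha>\<close> by (simp add: bregman_def)
  qed
  with T show ?thesis
    by blast
qed

end
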